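(* Let $(X,d_X,\leq_{P_1})$ and $(Y,d_Y,\leq_{P_2})$ be two partially ordered complete metric spaces and let $F:X\times Y\rightarrow X$, $G:Y\times X\rightarrow Y$ be two mappings (not assumed continuous) having the mixed monotone property. Assume that $X$ and $Y$ have the following properties: (i) if a non-decreasing sequence $\{x_j\}$ in $X$ converges to $x\in X$, then $x_j\leq_{P_1} x$ for all $j$; (ii) if a non-increasing sequence $\{y_j\}$ in $Y$ converges to $y\in Y$, then $y\leq_{P_2} y_j$ for all $j$. Also assume that there exist $k,l,m,n\in \left[0,\frac{1}{2}\right)$ satisfying $$d_X(F(x,y),F(u,v))\leq k\, d_X(x,F(u,v))+l\, d_X(u, F(x,y))\quad \text{for all } x,u\in X,\ y,v\in Y \text{ with } x\geq_{P_1}u,\ y\leq_{P_2}v,$$ $$d_Y(G(y,x),G(v,u))\leq m\, d_Y(y,G(v,u))+n\, d_Y(v,G(y,x))\quad \text{for all } x,u\in X,\ y,v\in Y \text{ with } x\leq_{P_1}u,\ y\geq_{P_2}v.$$ If there exist $x_0\in X$, $y_0\in Y$ satisfying $x_0\leq_{P_1} F(x_0, y_0)$ and $y_0\geq_{P_2} G(y_0, x_0)$, then there exist $x\in X$, $y\in Y$ such that $x=F(x,y)$ and $y=G(y,x)$.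
   Context: A partially ordered complete metric space $(X,d_X,\leq_{P_1})$ is a set $X$ with a metric $d_X$ for which it is complete and a partial order $\leq_{P_1}$ (no compatibility between them is assumed beyond what is stated). The maps $F:X\times Y\to X$ and $G:Y\times X\to Y$ have the mixed monotone property if for all $x\in X$, $y\in Y$: for all $x_1,x_2\in X$, $x_1\leq_{P_1} x_2$ implies $F(x_1,y)\leq_{P_1} F(x_2,y)$ and $G(y,x_1)\geq_{P_2}G(y,x_2)$; and for all $y_1,y_2\in Y$, $y_1\leq_{P_2}y_2$ implies $F(x,y_1)\geq_{P_1}F(x,y_2)$ and $G(y_1,x)\leq_{P_2}G(y_2,x)$. *)

theory Defs
  imports Complex_Main
begin

definition mixed_monotone ::
  "('a::order \<Rightarrow> 'b::order \<Rightarrow> 'a) \<Rightarrow> ('b \<Rightarrow> 'a \<Rightarrow> 'b) \<Rightarrow> bool" where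
  "mixed_monotone F G \<longleftrightarrow>
    (\<forall>x y.
      (\<forall>x1 x2. x1 \<le> x2 \<longrightarrow> F x1 y \<le> F x2 y \<and> G y x1 \<ge> G y x2) \<and>
      (\<forall>y1 y2. y1 \<le> y2 \<longrightarrow> F x y1 \<ge> F x y2 \<and> G y1 x \<le> G y2 x))"

end

theory Submission
  imports Defs
begin

text \<open>
  The iterates \<open>x\<^sub>j\<^sub>+\<^sub>1 = F x\<^sub>j y\<^sub>j\<close>, \<open>y\<^sub>j\<^sub>+\<^sub>1 = G y\<^sub>j x\<^sub>j\<close> form a non-decreasing and a
  non-increasing sequence. On consecutive iterates one of the two terms of each contraction
  condition vanishes, which leaves \<open>d(x\<^sub>j\<^sub>+\<^sub>1, x\<^sub>j\<^sub>+\<^sub>2) \<le> l d(x\<^sub>j, x\<^sub>j\<^sub>+\<^sub>2)\<close>; by the triangle inequality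
  consecutive distances then shrink by the factor \<open>l / (1 - l) < 1\<close>. The order properties make the
  limits comparable to the iterates, so the contraction conditions apply to them and give
  \<open>d(x, F x y) \<le> l d(x, F x y)\<close> in the limit.
\<close>

text \<open>Summing a geometric series bounds \<open>dist (s j) (s (j + i))\<close> by a null
  sequence in \<open>j\<close>, uniformly in \<open>i\<close>, so \<open>s\<close> is
  Cauchy.\<close>

lemma convergent_if_geometric_dist:
  fixes s :: "nat \<Rightarrow> 'a::complete_space"
  assumes r: "0 \<le> r" "r < 1"
    and step: "\<And>j. dist (s j) (s (Suc j)) \<le> D * r ^ j"
  shows "convergent s"
proof -
  \<comment> \<open>The exact partial sum is kept so that the induction on \<open>i\<close> closes;
    the cruder bound \<open>D * r ^ j / (1 - r)\<close> would not reproduce itself.\<close>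
  have tail: "dist (s j) (s (j + i)) \<le> D * r ^ j * (1 - r ^ i) / (1 - r)" for i j
  proof (induction i)
    case 0
    then show ?case by simp
  next
    case (Suc i)
    have "dist (s j) (s (j + Suc i)) \<le> dist (s j) (s (j + i)) + dist (s (j + i)) (s (Suc (j + i)))"
      using dist_triangle by simp
    also have "\<dots> \<le> D * r ^ j * (1 - r ^ i) / (1 - r) + D * r ^ (j + i)"
      using Suc step by (intro add_mono)
    also have "\<dots> = D * r ^ j * (1 - r ^ Suc i) / (1 - r)"
      using r by (simp add: field_simps power_add)
    finally show ?case .
  qed
  have D: "0 \<le> D"
    using order_trans[OF zero_le_dist step[of 0]] by simp
  have bound: "dist (s j) (s (j + i)) \<le> D / (1 - r) * r ^ j" for i j
  proof -
    have "D * r ^ j * (1 - r ^ i) \<le> D * r ^ j * 1"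
      using r D by (intro mult_left_mono) auto
    then have "D * r ^ j * (1 - r ^ i) / (1 - r) \<le> D * r ^ j / (1 - r)"
      using r by (intro divide_right_mono) auto
    then show ?thesis using tail[of j i] by simp
  qed
  have "(\<lambda>j. D / (1 - r) * r ^ j) \<longlonglongrightarrow> 0"
    using r by (intro tendsto_mult_right_zero LIMSEQ_realpow_zero)
  then have "\<exists>M. \<forall>j\<ge>M. D / (1 - r) * r ^ j < e" if "e > 0" for e
    using that by (auto dest: order_tendstoD(2) simp: eventually_sequentially)
  then have "Cauchy s"
    unfolding Cauchy_altdef by (metis bound le_add_diff_inverse less_imp_le order_le_less_trans)
  then show ?thesis
    by (rule Cauchy_convergent)
qed

lemma convergent_if_dist_Suc_le:
  fixes s :: "nat \<Rightarrow> 'a::complete_space"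
  assumes c: "0 \<le> c" "c < 1/2"
    and step: "\<And>j. dist (s (Suc j)) (s (Suc (Suc j))) \<le> c * dist (s j) (s (Suc (Suc j)))"
  shows "convergent s"
proof (rule convergent_if_geometric_dist)
  let ?r = "c / (1 - c)"
  show r: "0 \<le> ?r" "?r < 1"
    using c by auto
  show "dist (s j) (s (Suc j)) \<le> dist (s 0) (s 1) * ?r ^ j" for j
  proof (induction j)
    case 0
    then show ?case by simp
  next
    case (Suc j)
    have "dist (s (Suc j)) (s (Suc (Suc j)))
        \<le> c * (dist (s j) (s (Suc j)) + dist (s (Suc j)) (s (Suc (Suc j))))"
      using step[of j] mult_left_mono[OF dist_triangle c(1)] by (rule order_trans)
    \<comment> \<open>The term \<open>c * dist (s (Suc j)) (s (Suc (Suc j)))\<close> is absorbed on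
      the left, then \<open>1 - c > 0\<close> is divided out.\<close>
    then have "dist (s (Suc j)) (s (Suc (Suc j))) \<le> ?r * dist (s j) (s (Suc j))"
      using c by (simp add: field_simps)
    also have "\<dots> \<le> ?r * (dist (s 0) (s 1) * ?r ^ j)"
      using Suc r(1) by (rule mult_left_mono)
    finally show ?case by (simp add: mult_ac)
  qed
qed

text \<open>In the limit the \<open>a\<close> term vanishes and
  \<open>dist z w \<le> c * dist z w\<close> remains. With \<open>w\<close> the image of the limit,
  this replaces continuity of the map.\<close>

lemma limit_unique_if_dist_Suc_le:
  fixes s :: "nat \<Rightarrow> 'a::metric_space"
  assumes lim: "s \<longlonglongrightarrow> z" and c: "c < 1"
    and step: "\<And>j. dist (s (Suc j)) w \<le> a * dist (s (Suc j)) z + c * dist (s j) w"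
  shows "z = w"
proof -
  have "dist z w \<le> a * dist z z + c * dist z w"
  proof (rule LIMSEQ_le)
    show "(\<lambda>j. dist (s (Suc j)) w) \<longlonglongrightarrow> dist z w"
      by (intro tendsto_intros LIMSEQ_Suc[OF lim])
    show "(\<lambda>j. a * dist (s (Suc j)) z + c * dist (s j) w) \<longlonglongrightarrow> a * dist z z + c * dist z w"
      by (intro tendsto_intros lim LIMSEQ_Suc[OF lim])
  qed (use step in blast)
  then have "(1 - c) * dist z w \<le> 0"
    by (simp add: algebra_simps)
  then show ?thesis
    using c by (simp add: mult_le_0_iff)
qed

theorem theorem2p7:
  fixes F :: "'a::{complete_space, order} \<Rightarrow> 'b::{complete_space, order} \<Rightarrow> 'a"
    and G :: "'b \<Rightarrow> 'a \<Rightarrow> 'b"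
    and k l m n :: real
  assumes "mixed_monotone F G"
    and "\<And>(xs :: nat \<Rightarrow> 'a) x. incseq xs \<Longrightarrow> xs \<longlonglongrightarrow> x \<Longrightarrow> (\<forall>j. xs j \<le> x)"
    and "\<And>(ys :: nat \<Rightarrow> 'b) y. decseq ys \<Longrightarrow> ys \<longlonglongrightarrow> y \<Longrightarrow> (\<forall>j. y \<le> ys j)"
    and "k \<in> {0..<1/2}" "l \<in> {0..<1/2}" "m \<in> {0..<1/2}" "n \<in> {0..<1/2}"
    and "\<And>x u y v. x \<ge> u \<Longrightarrow> y \<le> v \<Longrightarrow>
      dist (F x y) (F u v) \<le> k * dist x (F u v) + l * dist u (F x y)"
    and "\<And>x u y v. x \<le> u \<Longrightarrow> y \<ge> v \<Longrightarrow>
      dist (G y x) (G v u) \<le> m * dist y (G v u) + n * dist v (G y x)"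
    and "\<exists>x0 y0. x0 \<le> F x0 y0 \<and> y0 \<ge> G y0 x0"
  shows "\<exists>x y. x = F x y \<and> y = G y x"
proof -
  have F_mono: "F x y \<le> F u v" if "x \<le> u" "v \<le> y" for x u y v
    using assms(1) that unfolding mixed_monotone_def by (meson order_trans)
  have G_mono: "G v u \<le> G y x" if "x \<le> u" "v \<le> y" for x u y v
    using assms(1) that unfolding mixed_monotone_def by (meson order_trans)
  obtain x0 y0 where init: "x0 \<le> F x0 y0" "G y0 x0 \<le> y0"
    using assms(10) by blast
  \<comment> \<open>The two recursions are coupled, so the pair is iterated.\<close>
  define p where "p j = ((\<lambda>(x, y). (F x y, G y x)) ^^ j) (x0, y0)" for j
  define xs ys where "xs j = fst (p j)" and "ys j = snd (p j)" for j
  have xs_Suc: "xs (Suc j) = F (xs j) (ys j)" and ys_Suc: "ys (Suc j) = G (ys j) (xs j)" for j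
    by (simp_all add: xs_def ys_def p_def split: prod.split)
  have mono: "xs j \<le> xs (Suc j) \<and> ys (Suc j) \<le> ys j" for j
  proof (induction j)
    case 0
    then show ?case using init by (simp add: xs_def ys_def p_def)
  next
    case (Suc j)
    then show ?case
      using F_mono G_mono by (metis xs_Suc ys_Suc)
  qed
  have "convergent xs"
  proof (rule convergent_if_dist_Suc_le)
    \<comment> \<open>The later iterate plays the larger point \<open>x\<close>, so the
      \<open>k\<close> term is the distance of \<open>xs (Suc j)\<close> to itself.\<close>
    show "dist (xs (Suc j)) (xs (Suc (Suc j))) \<le> l * dist (xs j) (xs (Suc (Suc j)))" for j
      using assms(8)[of "xs j" "xs (Suc j)" "ys (Suc j)" "ys j"] mono[of j]
      by (simp flip: xs_Suc add: dist_commute)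
  qed (use assms(5) in auto)
  then obtain x where x: "xs \<longlonglongrightarrow> x"
    by (auto simp: convergent_def)
  have "convergent ys"
  proof (rule convergent_if_dist_Suc_le)
    \<comment> \<open>Now the earlier iterate \<open>ys j\<close> is the larger point, so it is the
      \<open>n\<close> term that vanishes.\<close>
    show "dist (ys (Suc j)) (ys (Suc (Suc j))) \<le> m * dist (ys j) (ys (Suc (Suc j)))" for j
      using assms(9)[of "xs j" "xs (Suc j)" "ys (Suc j)" "ys j"] mono[of j]
      by (simp flip: ys_Suc)
  qed (use assms(6) in auto)
  then obtain y where y: "ys \<longlonglongrightarrow> y"
    by (auto simp: convergent_def)
  have xs_le: "xs j \<le> x" and le_ys: "y \<le> ys j" for j
    using assms(2)[OF incseq_SucI x] assms(3)[OF decseq_SucI y] mono by blast+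
  have "x = F x y"
  proof (rule limit_unique_if_dist_Suc_le[OF x])
    \<comment> \<open>The condition compares \<open>(x, y)\<close> with \<open>(xs j, ys j)\<close>,
      whose image under \<open>F\<close> is \<open>xs (Suc j)\<close>.\<close>
    show "dist (xs (Suc j)) (F x y) \<le> k * dist (xs (Suc j)) x + l * dist (xs j) (F x y)" for j
      using assms(8)[OF xs_le[of j] le_ys[of j]] by (simp flip: xs_Suc add: dist_commute)
  qed (use assms(5) in auto)
  moreover have "y = G y x"
  proof (rule limit_unique_if_dist_Suc_le[OF y])
    show "dist (ys (Suc j)) (G y x) \<le> n * dist (ys (Suc j)) y + m * dist (ys j) (G y x)" for j
      using assms(9)[OF xs_le[of j] le_ys[of j]] by (simp flip: ys_Suc add: dist_commute)
  qed (use assms(6) in auto)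
  ultimately show ?thesis by blast
qed

end
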